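(* Fix $k\in[0,1)$ and $L=0$. For an obstacle location $o\in[\frac12,1)$ and a possible mechanism output $(a,b)\in[0,o]\times[o,1]$, define $F_k(o,a,b)$ as the maximum approximation ratio $MC(a,b,\mathbf x)/\min_{(a',b')}MC(a',b',\mathbf x)$ over the $16$ four-agent profiles $\mathbf x=(x_l,x_r,y_l,y_r)$ obtained by independently choosing $$x_l\in\{0,a\},\quad x_r\in\{a,o^-\},\quad y_l\in\{o^+,b\},\quad y_r\in\{b,1\},$$ where $o^-$ and $o^+$ denote the limits $o-\varepsilon$ and $o+\varepsilon$ as $\varepsilon\to0^+$. Let $$B(k)=\sup_{o\in[\frac12,1)}\ \inf_{(a,b)\in[0,o]\times[o,1]}F_k(o,a,b).$$ Then every deterministic strategyproof mechanism has approximation ratio at least $B(k)$ for the maximum-cost objective. Moreover, $B(k)\ge\frac{2}{1+\sqrt k}$. If the numerical computation of $B(k)$ on a $1000\times1000$ grid gives the value $B_{1000}(k)$, then under the grid-error estimate (defined in the context), a safe reported lower bound is $$\max\left\{\frac{2}{1+\sqrt k},\ B_{1000}(k)-0.003\right\}.$$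
   Context: Setting ($L=0$). An instance consists of a point obstacle $o\in(0,1)$ and a profile $\mathbf x=(x_1,\ldots,x_n)$ of agent locations $x_i\in[0,o)\cup(o,1]$; $N=\{1,\ldots,n\}$, $N_1=\{i: x_i<o\}$, $N_2=\{i: x_i>o\}$. An edge is a pair $(a,b)$ with $a\in[0,o)$, $b\in(o,1]$. The cost of agent $i\in N_1$ is $cost(a,b,x_i)=|x_i-a|+k(b-a)+(1-b)$; the cost of agent $i\in N_2$ is $cost(a,b,x_i)=|x_i-b|+k(b-a)+a$. The maximum cost is $MC(a,b,\mathbf x)=\max_{i\in N}cost(a,b,x_i)$. In a four-agent profile $(x_l,x_r,y_l,y_r)$ the agents at $x_l,x_r$ belong to $N_1$ and those at $y_l,y_r$ to $N_2$; outputs with $a=o$ or $b=o$ are understood as limiting outputs. The obstacle is publicly known; a deterministic mechanism $f$ assigns an edge $f(\mathbf x)$ to each location profile (for every obstacle position $o$). It is strategyproof if for every agent $i$, every $\mathbf x$ and every $x_i'$ in the same region as $x_i$, $cost(f(x_i,\mathbf x_{-i}),x_i)\le cost(f(x_i',\mathbf x_{-i}),x_i)$, where $\mathbf x_{-i}$ is the profile of the other agents. Its approximation ratio is the least $\alpha$ with $MC(f(\mathbf x),\mathbf x)\le\alpha\cdot\min_{(a,b)}MC(a,b,\mathbf x)$ for all instances, including all obstacle positions. Only anonymous mechanisms (outcome invariant under permutations of the agents) are considered. Numerical part. $B_{1000}(k)$ is the value obtained when, in the definition of $B(k)$, the minimization over $(a,b)\in[0,o]\times[o,1]$ is carried out on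 a uniform $1000\times1000$ grid of that rectangle. Grid-error estimate: if, on the grid cells relevant to the numerical minimizer, $(a,b)\mapsto F_k(o,a,b)$ is $S$-Lipschitz in the $\ell_1$ metric, then the minimum over an $N\times N$ grid exceeds the continuous infimum by at most $\frac{S}{2(N-1)}$; the value $S=5$ is adopted as a conservative choice based on observed local slopes (not proved), giving for $N=1000$ an error of at most $\frac{5}{2\cdot 999}<0.0026$, rounded up to $0.003$. *)

theory Defs
  imports "HOL-Analysis.Analysis"
begin

text \<open>
  The obstacle is the point \<open>ob\<close> with \<open>0 < ob < 1\<close>. A profile of any number \<open>n \<ge> 1\<close> of agents is a
  nonempty list of locations.
\<close>

definition is_profile :: "real \<Rightarrow> real list \<Rightarrow> bool" where
  "is_profile ob xs \<longleftrightarrow> xs \<noteq> [] \<and> set xs \<subseteq> {0..<ob} \<union> {ob<..1}"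

definition edges :: "real \<Rightarrow> (real \<times> real) set" where
  "edges ob = {0..<ob} \<times> {ob<..1}"

fun cost1 :: "real \<Rightarrow> real \<times> real \<Rightarrow> real \<Rightarrow> real" where
  "cost1 k (a, b) x = \<bar>x - a\<bar> + k * (b - a) + (1 - b)"

fun cost2 :: "real \<Rightarrow> real \<times> real \<Rightarrow> real \<Rightarrow> real" where
  "cost2 k (a, b) x = \<bar>x - b\<bar> + k * (b - a) + a"

definition cost :: "real \<Rightarrow> real \<Rightarrow> real \<times> real \<Rightarrow> real \<Rightarrow> real" where
  "cost k ob e x = (if x < ob then cost1 k e x else cost2 k e x)"

text \<open>
  The maximum cost depends only on the sets \<open>X\<close> and \<open>Y\<close> of locations of the agents of \<open>N\<^sub>1\<close> and of
  \<open>N\<^sub>2\<close>. Keeping the two sets separate lets an agent location tend to the obstacle, or coincide with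
  an endpoint \<open>a = ob\<close> or \<open>b = ob\<close> of a limiting output, without losing its region.
\<close>

definition max_cost :: "real \<Rightarrow> real \<times> real \<Rightarrow> real set \<Rightarrow> real set \<Rightarrow> real" where
  "max_cost k e X Y = Max (cost1 k e ` X \<union> cost2 k e ` Y)"

definition opt_cost :: "real \<Rightarrow> real \<Rightarrow> real set \<Rightarrow> real set \<Rightarrow> real" where
  "opt_cost k ob X Y = (INF e\<in>edges ob. max_cost k e X Y)"

definition N1_locs :: "real \<Rightarrow> real list \<Rightarrow> real set" where
  "N1_locs ob xs = {x \<in> set xs. x < ob}"

definition N2_locs :: "real \<Rightarrow> real list \<Rightarrow> real set" where
  "N2_locs ob xs = {x \<in> set xs. ob < x}"

definition MC :: "real \<Rightarrow> real \<Rightarrow> real \<times> real \<Rightarrow> real list \<Rightarrow> real" where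
  "MC k ob e xs = max_cost k e (N1_locs ob xs) (N2_locs ob xs)"

definition OPT :: "real \<Rightarrow> real \<Rightarrow> real list \<Rightarrow> real" where
  "OPT k ob xs = opt_cost k ob (N1_locs ob xs) (N2_locs ob xs)"

text \<open>A mechanism maps the (public) obstacle position and the reported profile to an edge.\<close>

type_synonym mechanism = "real \<Rightarrow> real list \<Rightarrow> real \<times> real"

definition is_mechanism :: "mechanism \<Rightarrow> bool" where
  "is_mechanism f \<longleftrightarrow> (\<forall>ob\<in>{0<..<1}. \<forall>xs. is_profile ob xs \<longrightarrow> f ob xs \<in> edges ob)"

definition anonymous :: "mechanism \<Rightarrow> bool" where
  "anonymous f \<longleftrightarrow>
    (\<forall>ob\<in>{0<..<1}. \<forall>xs ys. is_profile ob xs \<longrightarrow> mset xs = mset ys \<longrightarrow> f ob xs = f ob ys)"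

definition same_region :: "real \<Rightarrow> real \<Rightarrow> real \<Rightarrow> bool" where
  "same_region ob x x' \<longleftrightarrow> x \<in> {0..<ob} \<and> x' \<in> {0..<ob} \<or> x \<in> {ob<..1} \<and> x' \<in> {ob<..1}"

definition strategyproof :: "real \<Rightarrow> mechanism \<Rightarrow> bool" where
  "strategyproof k f \<longleftrightarrow>
    (\<forall>ob\<in>{0<..<1}. \<forall>xs. is_profile ob xs \<longrightarrow>
      (\<forall>i<length xs. \<forall>x'. same_region ob (xs ! i) x' \<longrightarrow>
        cost k ob (f ob xs) (xs ! i) \<le> cost k ob (f ob (xs[i := x'])) (xs ! i)))"

text \<open>Extended-real valued: the value is \<open>\<infinity>\<close> if no constant \<open>\<alpha>\<close> works for all instances.\<close>

definition approx_ratio :: "real \<Rightarrow> mechanism \<Rightarrow> ereal" where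
  "approx_ratio k f =
    Inf (ereal ` {\<alpha>. \<forall>ob\<in>{0<..<1}. \<forall>xs. is_profile ob xs \<longrightarrow>
                     MC k ob (f ob xs) xs \<le> \<alpha> * OPT k ob xs})"

text \<open>
  Division by zero: the optimum of one of the profiles below vanishes only if \<open>k = 0\<close>,
  \<open>(a, b) = (0, 1)\<close> and the profile is \<open>(0, 0, 1, 1)\<close>. The quotient is then \<open>0 / 0 = 0\<close> and does not
  affect the maximum, since all other quotients are at least 1. The limit in \<open>F\<close> exists, because the
  maximum and optimal costs are 1-Lipschitz in the agent locations.
\<close>

definition F_eps :: "real \<Rightarrow> real \<Rightarrow> real \<Rightarrow> real \<Rightarrow> real \<Rightarrow> real" where
  "F_eps k ob a b \<epsilon> =
    Max ((\<lambda>(xl, xr, yl, yr). max_cost k (a, b) {xl, xr} {yl, yr} / opt_cost k ob {xl, xr} {yl, yr}) `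
         ({0, a} \<times> {a, ob - \<epsilon>} \<times> {ob + \<epsilon>, b} \<times> {b, 1}))"

definition F :: "real \<Rightarrow> real \<Rightarrow> real \<Rightarrow> real \<Rightarrow> real" where
  "F k ob a b = Lim (at_right 0) (F_eps k ob a b)"

definition F_inf :: "real \<Rightarrow> real \<Rightarrow> real" where
  "F_inf k ob = (INF (a, b)\<in>{0..ob} \<times> {ob..1}. F k ob a b)"

definition B :: "real \<Rightarrow> real" where
  "B k = (SUP ob\<in>{1/2..<1}. F_inf k ob)"

text \<open>
  The uniform \<open>N \<times> N\<close> grid of the rectangle, for \<open>N \<ge> 2\<close>: it has \<open>N\<close> points in each direction,
  including the end points, and hence \<open>N - 1\<close> cells in each direction.
\<close>

definition grid_a :: "nat \<Rightarrow> real \<Rightarrow> nat \<Rightarrow> real" where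
  "grid_a N ob i = ob * (real i / (real N - 1))"

definition grid_b :: "nat \<Rightarrow> real \<Rightarrow> nat \<Rightarrow> real" where
  "grid_b N ob j = ob + (1 - ob) * (real j / (real N - 1))"

definition F_grid_min :: "nat \<Rightarrow> real \<Rightarrow> real \<Rightarrow> real" where
  "F_grid_min N k ob = Min ((\<lambda>(i, j). F k ob (grid_a N ob i) (grid_b N ob j)) ` ({..<N} \<times> {..<N}))"

definition B_grid :: "nat \<Rightarrow> real \<Rightarrow> real" where
  "B_grid N k = (SUP ob\<in>{1/2..<1}. F_grid_min N k ob)"

definition grid_cell :: "nat \<Rightarrow> real \<Rightarrow> nat \<Rightarrow> nat \<Rightarrow> (real \<times> real) set" where
  "grid_cell N ob i j =
    {grid_a N ob i..grid_a N ob (Suc i)} \<times> {grid_b N ob j..grid_b N ob (Suc j)}"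

text \<open>The cells relevant to the minimization are those whose infimum equals the infimum over the rectangle.\<close>

definition relevant_cell :: "nat \<Rightarrow> real \<Rightarrow> real \<Rightarrow> nat \<Rightarrow> nat \<Rightarrow> bool" where
  "relevant_cell N k ob i j \<longleftrightarrow>
    i < N - 1 \<and> j < N - 1 \<and> (INF (a, b)\<in>grid_cell N ob i j. F k ob a b) = F_inf k ob"

definition l1_lipschitz_on :: "real \<Rightarrow> (real \<times> real) set \<Rightarrow> (real \<Rightarrow> real \<Rightarrow> real) \<Rightarrow> bool" where
  "l1_lipschitz_on S C g \<longleftrightarrow>
    (\<forall>(a, b)\<in>C. \<forall>(a', b')\<in>C. \<bar>g a b - g a' b'\<bar> \<le> S * (\<bar>a - a'\<bar> + \<bar>b - b'\<bar>))"

definition locally_lipschitz :: "real \<Rightarrow> nat \<Rightarrow> real \<Rightarrow> real \<Rightarrow> bool" where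
  "locally_lipschitz S N k ob \<longleftrightarrow>
    (\<forall>i j. relevant_cell N k ob i j \<longrightarrow> l1_lipschitz_on S (grid_cell N ob i j) (F k ob))"

definition grid_error_bound :: "real \<Rightarrow> nat \<Rightarrow> real \<Rightarrow> real \<Rightarrow> bool" where
  "grid_error_bound S N k ob \<longleftrightarrow> F_grid_min N k ob \<le> F_inf k ob + S / (2 * (real N - 1))"

end

theory Submission
  imports Defs
begin

text \<open>
  The number \<open>2 / (1 + k)\<close> separates \<open>B k\<close> from the ratio of every strategyproof mechanism.

  On the one hand \<open>B k \<le> 2 / (1 + k)\<close>, because for every obstacle the output \<open>(ob, ob)\<close> satisfies
  \<open>F k ob ob ob \<le> 2 / (1 + k)\<close>. On the other hand no strategyproof mechanism beats \<open>2 / (1 + k)\<close>: this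
  is already seen on two agents \<open>z < x\<close> in the region \<open>N\<^sub>1\<close>, with \<open>x\<close> and the obstacle close to 1. There
  the optimum is about \<open>(1 + k) (1 - z) / 2\<close>, so a ratio below \<open>2 / (1 + k)\<close> forces \<open>1 - a\<close> to be smaller
  than \<open>1 - z\<close> by a constant factor. Hence \<open>z\<close> can be moved towards 1 in geometric steps while staying
  to the left of \<open>a\<close>, where its cost is \<open>1 - z - (1 - k) (b - a)\<close>. By strategyproofness \<open>b - a\<close> never
  decreases, although \<open>b - a \<le> 1 - a\<close> tends to 0; and \<open>b - a\<close> is bounded away from 0 at the start \<open>z = 0\<close>.

  The bound \<open>2 / (1 + sqrt k) \<le> B k\<close> comes from \<open>ob = 1/2\<close>. With \<open>r = sqrt k\<close>, the profile
  \<open>(0, a, b, 1)\<close> is bad if \<open>b - a < 1 / (1 + r)\<close>; otherwise \<open>(a, ob, b, b)\<close> or \<open>(a, a, ob, b)\<close> is bad,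
  depending on the sign of \<open>a + b - 1\<close>.
\<close>

subsection \<open>Maximum cost and optimal cost\<close>

lemma max_cost_le_iff:
  assumes "finite X" "finite Y" "X \<union> Y \<noteq> {}"
  shows "max_cost k e X Y \<le> c \<longleftrightarrow> (\<forall>x\<in>X. cost1 k e x \<le> c) \<and> (\<forall>y\<in>Y. cost2 k e y \<le> c)"
  using assms by (auto simp: max_cost_def)

lemma cost1_le_max_cost:
  assumes "finite X" "finite Y" "x \<in> X"
  shows "cost1 k e x \<le> max_cost k e X Y"
  using assms by (auto simp: max_cost_def)

lemma cost2_le_max_cost:
  assumes "finite X" "finite Y" "y \<in> Y"
  shows "cost2 k e y \<le> max_cost k e X Y"
  using assms by (auto simp: max_cost_def)

lemma max_cost_nonneg:
  assumes "0 \<le> k" "0 \<le> a" "a \<le> b" "b \<le> 1" "finite X" "finite Y" "X \<union> Y \<noteq> {}"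
  shows "0 \<le> max_cost k (a, b) X Y"
proof -
  have k: "0 \<le> k * (b - a)"
    using assms by simp
  have "0 \<le> cost1 k (a, b) x" "0 \<le> cost2 k (a, b) x" for x
    using assms k by auto
  then show ?thesis
    using assms cost1_le_max_cost[of X Y _ k "(a, b)"] cost2_le_max_cost[of X Y _ k "(a, b)"]
    by (metis Un_iff ex_in_conv order_trans)
qed

lemma edges_max_cost_nonneg:
  assumes "0 \<le> k" "e \<in> edges ob" "finite X" "finite Y" "X \<union> Y \<noteq> {}"
  shows "0 \<le> max_cost k e X Y"
  using assms by (cases e) (auto simp: edges_def intro!: max_cost_nonneg)

lemma opt_cost_le:
  assumes "0 \<le> k" "e \<in> edges ob" "finite X" "finite Y" "X \<union> Y \<noteq> {}"
  shows "opt_cost k ob X Y \<le> max_cost k e X Y"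
  unfolding opt_cost_def
proof (rule cINF_lower)
  show "bdd_below ((\<lambda>e. max_cost k e X Y) ` edges ob)"
    using edges_max_cost_nonneg assms by (intro bdd_belowI2[where m = 0]) auto
qed (use assms in auto)

lemma opt_cost_ge:
  assumes "0 < ob" "ob < 1" "\<And>e. e \<in> edges ob \<Longrightarrow> c \<le> max_cost k e X Y"
  shows "c \<le> opt_cost k ob X Y"
  unfolding opt_cost_def
proof (rule cINF_greatest)
  show "edges ob \<noteq> {}"
    using assms by (auto simp: edges_def)
qed (use assms in auto)

lemma opt_cost_nonneg:
  assumes "0 \<le> k" "0 < ob" "ob < 1" "finite X" "finite Y" "X \<union> Y \<noteq> {}"
  shows "0 \<le> opt_cost k ob X Y"
  using assms by (intro opt_cost_ge edges_max_cost_nonneg)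

text \<open>
  The two agents next to the obstacle pull the edge apart and their average cost is at least
  \<open>k (b - a) + (xr + 1 - yl) / 2\<close>, whereas an extreme agent pays at least \<open>p - (1 - k) (b - a)\<close>.
  The weights \<open>1 - k\<close> and \<open>k\<close> eliminate \<open>b - a\<close>.
\<close>

lemma max_cost_ge:
  assumes "0 \<le> k" "k \<le> 1" "finite X" "finite Y" "xr \<in> X" "yl \<in> Y"
    and p: "1 - p \<in> X \<or> p \<in> Y"
  shows "k * p + (1 - k) * (xr + 1 - yl) / 2 \<le> max_cost k e X Y"
proof (cases e)
  case (Pair a b)
  let ?m = "max_cost k e X Y"
  have "xr - a + k * (b - a) + (1 - b) \<le> ?m"
    using cost1_le_max_cost[OF assms(3-5), of k e] Pair by auto
  moreover have "b - yl + k * (b - a) + a \<le> ?m"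
    using cost2_le_max_cost[OF assms(3,4,6), of k e] Pair by auto
  ultimately have 1: "k * (b - a) + (xr + 1 - yl) / 2 \<le> ?m"
    by (simp add: field_simps)
  have "p - (b - a) + k * (b - a) \<le> ?m"
    using p
  proof
    assume "1 - p \<in> X"
    from cost1_le_max_cost[OF assms(3,4) this, of k e] show ?thesis
      using Pair by auto
  next
    assume "p \<in> Y"
    from cost2_le_max_cost[OF assms(3,4) this, of k e] show ?thesis
      using Pair by auto
  qed
  then have 2: "p - (1 - k) * (b - a) \<le> ?m"
    by (simp add: algebra_simps)
  have "(1 - k) * (k * (b - a) + (xr + 1 - yl) / 2) + k * (p - (1 - k) * (b - a)) \<le> (1 - k) * ?m + k * ?m"
    using assms by (intro add_mono mult_left_mono 1 2) auto
  then show ?thesis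
    by (simp add: field_simps)
qed

lemma opt_cost_lower_bound:
  assumes "0 \<le> k" "k \<le> 1" "0 < ob" "ob < 1" "finite X" "finite Y" "xr \<in> X" "yl \<in> Y"
    and "1 - p \<in> X \<or> p \<in> Y"
  shows "k * p + (1 - k) * (xr + 1 - yl) / 2 \<le> opt_cost k ob X Y"
  using assms by (intro opt_cost_ge max_cost_ge)

text \<open>Taking \<open>p = yl\<close> in the lower bound leaves a nonnegative term plus a
  positive one. This justifies dividing by the optimum later on.\<close>

lemma opt_cost_pos:
  assumes "0 \<le> k" "k < 1" "0 < ob" "ob < 1" "finite X" "finite Y" "xr \<in> X" "yl \<in> Y"
    and "0 \<le> yl" "yl < xr + 1"
  shows "0 < opt_cost k ob X Y"
proof -
  have "0 < k * yl + (1 - k) * (xr + 1 - yl) / 2"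
    using assms by (intro add_nonneg_pos) auto
  also have "\<dots> \<le> opt_cost k ob X Y"
    using assms by (intro opt_cost_lower_bound) auto
  finally show ?thesis .
qed

section \<open>Dependence of the costs on the agent locations\<close>

lemma cost1_lipschitz: "cost1 k e x \<le> cost1 k e x' + \<bar>x - x'\<bar>"
  by (cases e) auto

lemma cost2_lipschitz: "cost2 k e y \<le> cost2 k e y' + \<bar>y - y'\<bar>"
  by (cases e) auto

lemma max_cost_perturb:
  assumes "\<bar>x - x'\<bar> \<le> \<delta>" "\<bar>y - y'\<bar> \<le> \<delta>"
  shows "max_cost k e {u, x} {y, v} \<le> max_cost k e {u, x'} {y', v} + \<delta>"
proof -
  have "0 \<le> \<delta>"
    using assms by linarith
  then have "cost1 k e u \<le> max_cost k e {u, x'} {y', v} + \<delta>" "cost2 k e v \<le> max_cost k e {u, x'} {y', v} + \<delta>"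
    using cost1_le_max_cost[of "{u, x'}" "{y', v}" u k e] cost2_le_max_cost[of "{u, x'}" "{y', v}" v k e]
    by auto
  moreover have "cost1 k e x \<le> max_cost k e {u, x'} {y', v} + \<delta>" "cost2 k e y \<le> max_cost k e {u, x'} {y', v} + \<delta>"
    using cost1_le_max_cost[of "{u, x'}" "{y', v}" x' k e] cost2_le_max_cost[of "{u, x'}" "{y', v}" y' k e]
      cost1_lipschitz[of k e x x'] cost2_lipschitz[of k e y y'] assms
    by auto
  ultimately show ?thesis
    by (subst max_cost_le_iff) auto
qed

lemma opt_cost_perturb:
  assumes "0 \<le> k" "0 < ob" "ob < 1" "\<bar>x - x'\<bar> \<le> \<delta>" "\<bar>y - y'\<bar> \<le> \<delta>"
  shows "opt_cost k ob {u, x} {y, v} \<le> opt_cost k ob {u, x'} {y', v} + \<delta>"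
proof -
  have "opt_cost k ob {u, x} {y, v} - \<delta> \<le> opt_cost k ob {u, x'} {y', v}"
  proof (rule opt_cost_ge)
    fix e assume "e \<in> edges ob"
    then have "opt_cost k ob {u, x} {y, v} \<le> max_cost k e {u, x} {y, v}"
      using assms by (intro opt_cost_le) auto
    with max_cost_perturb[OF assms(4,5), of k e u v]
    show "opt_cost k ob {u, x} {y, v} - \<delta> \<le> max_cost k e {u, x'} {y', v}"
      by linarith
  qed (use assms in auto)
  then show ?thesis
    by simp
qed

lemma tendsto_Max:
  fixes f :: "'i \<Rightarrow> 'a \<Rightarrow> real"
  assumes "finite I" "I \<noteq> {}" "\<And>i. i \<in> I \<Longrightarrow> (f i \<longlongrightarrow> l i) G"
  shows "((\<lambda>x. Max ((\<lambda>i. f i x) ` I)) \<longlongrightarrow> Max (l ` I)) G"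
  using assms
proof (induction I rule: finite_ne_induct)
  case (insert i I)
  then have "((\<lambda>x. max (f i x) (Max ((\<lambda>i. f i x) ` I))) \<longlongrightarrow> max (l i) (Max (l ` I))) G"
    by (intro tendsto_max) auto
  then show ?case
    using insert by simp
qed auto

subsection \<open>The worst ratio of an output\<close>

definition ratio :: "real \<Rightarrow> real \<Rightarrow> real \<times> real \<Rightarrow> real set \<Rightarrow> real set \<Rightarrow> real" where
  "ratio k ob e X Y = max_cost k e X Y / opt_cost k ob X Y"

text \<open>The booleans record whether the inner agents sit next to the obstacle. The index set is
  thus independent of \<epsilon>, and the limit of the maximum can be taken term by term.\<close>

abbreviation choices :: "real \<Rightarrow> real \<Rightarrow> (real \<times> bool \<times> bool \<times> real) set" where
  "choices a b \<equiv> {0, a} \<times> UNIV \<times> UNIV \<times> {b, 1}"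

lemma F_eps_eq:
  "F_eps k ob a b \<epsilon> =
    Max ((\<lambda>(xl, p, q, yr). ratio k ob (a, b) {xl, if p then ob - \<epsilon> else a} {if q then ob + \<epsilon> else b, yr}) `
      choices a b)"
proof -
  have *: "{0, a} \<times> {a, ob - \<epsilon>} \<times> {ob + \<epsilon>, b} \<times> {b, 1} =
    (\<lambda>(xl, p, q, yr). (xl, if p then ob - \<epsilon> else a, if q then ob + \<epsilon> else b, yr)) ` choices a b"
    by (auto simp: image_iff UNIV_bool Bex_def split: if_splits)
  show ?thesis
    unfolding F_eps_def * image_image ratio_def by (simp add: case_prod_unfold)
qed

lemma tendsto_dist_bound:
  fixes f :: "real \<Rightarrow> real"
  assumes "\<And>\<epsilon>. 0 < \<epsilon> \<Longrightarrow> f \<epsilon> \<le> l + \<epsilon>" "\<And>\<epsilon>. 0 < \<epsilon> \<Longrightarrow> l \<le> f \<epsilon> + \<epsilon>"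
  shows "(f \<longlongrightarrow> l) (at_right 0)"
proof (rule Lim_null[THEN iffD2], rule Lim_null_comparison)
  show "\<forall>\<^sub>F \<epsilon> in at_right 0. norm (f \<epsilon> - l) \<le> \<epsilon>"
    using assms unfolding eventually_at_right_field by (intro exI[of _ 1]) (fastforce simp: abs_le_iff)
qed (rule tendsto_ident_at)

text \<open>If an inner agent tends to the obstacle, the limiting optimum is positive and the
  quotient converges. Otherwise nothing depends on \<epsilon>, so even a quotient
  \<open>0 / 0\<close> is harmless.\<close>

lemma ratio_tendsto:
  assumes "0 \<le> k" "k < 1" "0 < ob" "ob < 1" "0 \<le> a" "b \<le> 1" "0 \<le> b"
  shows "((\<lambda>\<epsilon>. ratio k ob e {xl, if p then ob - \<epsilon> else a} {if q then ob + \<epsilon> else b, yr})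
    \<longlongrightarrow> ratio k ob e {xl, if p then ob else a} {if q then ob else b, yr}) (at_right 0)"
proof (cases "p \<or> q")
  case True
  have "opt_cost k ob {xl, if p then ob else a} {if q then ob else b, yr} \<noteq> 0"
    using opt_cost_pos[of k ob "{xl, if p then ob else a}" "{if q then ob else b, yr}"
        "if p then ob else a" "if q then ob else b"] assms True
    by auto
  moreover have "((\<lambda>\<epsilon>. max_cost k e {xl, if p then ob - \<epsilon> else a} {if q then ob + \<epsilon> else b, yr})
    \<longlongrightarrow> max_cost k e {xl, if p then ob else a} {if q then ob else b, yr}) (at_right 0)"
    by (rule tendsto_dist_bound; rule max_cost_perturb) auto
  moreover have "((\<lambda>\<epsilon>. opt_cost k ob {xl, if p then ob - \<epsilon> else a} {if q then ob + \<epsilon> else b, yr})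
    \<longlongrightarrow> opt_cost k ob {xl, if p then ob else a} {if q then ob else b, yr}) (at_right 0)"
    by (rule tendsto_dist_bound; rule opt_cost_perturb) (use assms in auto)
  ultimately show ?thesis
    unfolding ratio_def by (intro tendsto_divide)
qed auto

text \<open>Evaluation at 0 makes sense because the two regions are kept as separate sets: an agent
  placed at \<open>ob\<close> keeps its region.\<close>

lemma F_eq_F_eps_0:
  assumes "0 \<le> k" "k < 1" "0 < ob" "ob < 1" "0 \<le> a" "b \<le> 1" "0 \<le> b"
  shows "F k ob a b = F_eps k ob a b 0"
proof -
  have "((\<lambda>\<epsilon>. F_eps k ob a b \<epsilon>) \<longlongrightarrow> F_eps k ob a b 0) (at_right 0)"
    unfolding F_eps_eq
  proof (rule tendsto_Max)
    fix i :: "real \<times> bool \<times> bool \<times> real"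
    show "((\<lambda>\<epsilon>. case i of (xl, p, q, yr) \<Rightarrow>
          ratio k ob (a, b) {xl, if p then ob - \<epsilon> else a} {if q then ob + \<epsilon> else b, yr}) \<longlongrightarrow>
        (case i of (xl, p, q, yr) \<Rightarrow>
          ratio k ob (a, b) {xl, if p then ob - 0 else a} {if q then ob + 0 else b, yr})) (at_right 0)"
      using ratio_tendsto[OF assms] by (cases i) (simp only: prod.case diff_0_right add_0_right)
  qed auto
  then show ?thesis
    unfolding F_def by (intro tendsto_Lim) auto
qed

lemma F_ge_ratio:
  assumes "0 \<le> k" "k < 1" "0 < ob" "ob < 1" "0 \<le> a" "b \<le> 1" "0 \<le> b"
    and "xl \<in> {0, a}" "xr \<in> {a, ob}" "yl \<in> {ob, b}" "yr \<in> {b, 1}"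
  shows "ratio k ob (a, b) {xl, xr} {yl, yr} \<le> F k ob a b"
  unfolding F_eq_F_eps_0[OF assms(1-7)] F_eps_def
  by (rule Max_ge) (use assms(8-) in \<open>force simp: ratio_def\<close>)+

lemma F_le:
  assumes "0 \<le> k" "k < 1" "0 < ob" "ob < 1" "0 \<le> a" "b \<le> 1" "0 \<le> b"
    and "\<And>xl xr yl yr. \<lbrakk>xl \<in> {0, a}; xr \<in> {a, ob}; yl \<in> {ob, b}; yr \<in> {b, 1}\<rbrakk> \<Longrightarrow>
      ratio k ob (a, b) {xl, xr} {yl, yr} \<le> c"
  shows "F k ob a b \<le> c"
  unfolding F_eq_F_eps_0[OF assms(1-7)] F_eps_def
  by (rule Max.boundedI) (use assms(8) in \<open>force simp: ratio_def\<close>)+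

lemma F_nonneg:
  assumes "0 \<le> k" "k < 1" "0 < ob" "ob < 1" "0 \<le> a" "a \<le> b" "b \<le> 1"
  shows "0 \<le> F k ob a b"
proof -
  have "0 \<le> ratio k ob (a, b) {a, a} {b, b}"
    unfolding ratio_def using assms
    by (intro divide_nonneg_nonneg max_cost_nonneg opt_cost_nonneg) auto
  also have "\<dots> \<le> F k ob a b"
    using assms by (intro F_ge_ratio) auto
  finally show ?thesis .
qed

section \<open>The upper bound \<open>2 / (1 + k)\<close> for \<open>B k\<close>\<close>

lemma F_inf_le:
  assumes "0 \<le> k" "k < 1" "0 < ob" "ob < 1" "0 \<le> a" "a \<le> ob" "ob \<le> b" "b \<le> 1"
  shows "F_inf k ob \<le> F k ob a b"
proof -
  have "bdd_below ((\<lambda>(a, b). F k ob a b) ` ({0..ob} \<times> {ob..1}))"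
    using assms by (intro bdd_belowI2[where m = 0]) (auto intro!: F_nonneg)
  from cINF_lower[OF this, of "(a, b)"] show ?thesis
    using assms by (simp add: F_inf_def)
qed

text \<open>For the output \<open>(ob, ob)\<close> an agent of the first region pays
  \<open>1 - x\<close> and one of the second pays \<open>y\<close>. The largest of these costs is
  \<open>p\<close>, while the optimum is at least \<open>k * p + (1 - k) / 2\<close>. The quotient
  increases with \<open>p\<close> and equals \<open>2 / (1 + k)\<close> at
  \<open>p = 1\<close>.\<close>

lemma F_obstacle_le:
  assumes "0 \<le> k" "k < 1" "1 / 2 \<le> ob" "ob < 1"
  shows "F k ob ob ob \<le> 2 / (1 + k)"
proof (rule F_le)
  fix xl xr yl yr
  assume *: "xl \<in> {0, ob}" "xr \<in> {ob, ob}" "yl \<in> {ob, ob}" "yr \<in> {ob, 1}"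
  define p where "p = max (1 - xl) yr"
  have p: "1 - p \<in> {xl, xr} \<or> p \<in> {yl, yr}" "1 / 2 \<le> p" "p \<le> 1"
    using * assms by (auto simp: p_def max_def)
  have "max_cost k (ob, ob) {xl, xr} {yl, yr} \<le> p"
    using * assms by (subst max_cost_le_iff) (auto simp: p_def)
  also have "p \<le> 2 / (1 + k) * (k * p + (1 - k) * (xr + 1 - yl) / 2)"
  proof -
    have "(1 - k) * p \<le> (1 - k) * 1"
      using p assms by (intro mult_left_mono) auto
    then show ?thesis
      using * assms by (auto simp: field_simps)
  qed
  also have "\<dots> \<le> 2 / (1 + k) * opt_cost k ob {xl, xr} {yl, yr}"
    using p assms by (intro mult_left_mono opt_cost_lower_bound) auto
  finally have "max_cost k (ob, ob) {xl, xr} {yl, yr} \<le> 2 / (1 + k) * opt_cost k ob {xl, xr} {yl, yr}" .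
  moreover have "0 < opt_cost k ob {xl, xr} {yl, yr}"
    using * assms by (intro opt_cost_pos[of _ _ _ _ xr yl]) auto
  ultimately show "ratio k ob (ob, ob) {xl, xr} {yl, yr} \<le> 2 / (1 + k)"
    unfolding ratio_def by (subst pos_divide_le_eq)
qed (use assms in auto)

lemma F_inf_upper_bound:
  assumes "0 \<le> k" "k < 1" "1 / 2 \<le> ob" "ob < 1"
  shows "F_inf k ob \<le> 2 / (1 + k)"
  using F_inf_le[of k ob ob ob] F_obstacle_le[OF assms] assms by simp

lemma F_inf_le_B:
  assumes "0 \<le> k" "k < 1" "ob \<in> {1/2..<1}"
  shows "F_inf k ob \<le> B k"
  unfolding B_def
proof (rule cSUP_upper[OF assms(3)])
  show "bdd_above (F_inf k ` {1/2..<1})"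
    using F_inf_upper_bound assms by (intro bdd_aboveI2) auto
qed

lemma B_le:
  assumes "0 \<le> k" "k < 1"
  shows "B k \<le> 2 / (1 + k)"
  unfolding B_def
  by (rule cSUP_least) (use F_inf_upper_bound assms in auto)

subsection \<open>The obstacle at one half\<close>

text \<open>The optimum is bounded from above by a competing edge \<open>(a', b')\<close> on which
  nobody pays more than \<open>v\<close>; the agents \<open>xr\<close> and \<open>yl\<close> witness
  that it is positive.\<close>

lemma le_ratioI:
  assumes "0 \<le> k" "k < 1" "0 < ob" "ob < 1" "finite X" "finite Y" "xr \<in> X" "yl \<in> Y"
    and "0 \<le> yl" "yl < xr + 1"
    and "a' \<in> {0..<ob}" "b' \<in> {ob<..1}" "0 \<le> c"
    and opt: "\<And>x. x \<in> X \<Longrightarrow> cost1 k (a', b') x \<le> v" "\<And>y. y \<in> Y \<Longrightarrow> cost2 k (a', b') y \<le> v"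
    and cost: "c * v \<le> max_cost k e X Y"
  shows "c \<le> ratio k ob e X Y"
proof -
  have "opt_cost k ob X Y \<le> max_cost k (a', b') X Y"
    using assms by (intro opt_cost_le) (auto simp: edges_def)
  also have "\<dots> \<le> v"
    using assms by (subst max_cost_le_iff) auto
  finally have "c * opt_cost k ob X Y \<le> c * v"
    using assms by (intro mult_left_mono)
  moreover have "0 < opt_cost k ob X Y"
    using assms by (intro opt_cost_pos[of _ _ _ _ xr yl])
  ultimately show ?thesis
    unfolding ratio_def using cost by (subst pos_le_divide_eq) auto
qed

text \<open>Here \<open>r\<close> is \<open>sqrt k\<close>. The competing edge puts each end midway
  between the two agents of its region, so that all four pay the same, whereas the given edge
  charges the agent at 0 the amount \<open>1 - u\<close>.\<close>

lemma F_half_ge_short: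
  assumes "0 \<le> r" "r < 1" "0 \<le> a" "a \<le> 1/2" "1/2 \<le> b" "b \<le> 1" "b - a < 1 / (1 + r)"
  shows "2 / (1 + r) \<le> F (r\<^sup>2) (1/2) a b"
proof -
  define s where "s = b - a"
  define u where "u = (1 - r\<^sup>2) * s"
  have r2: "0 \<le> r\<^sup>2" "r\<^sup>2 < 1"
    using assms by (auto simp: power_less_one_iff)
  have "s * (1 + r) < 1"
    using assms by (simp add: s_def pos_less_divide_eq)
  moreover have "s * 1 \<le> s * (1 + r)"
    using assms by (intro mult_left_mono) (auto simp: s_def)
  ultimately have s: "s < 1" by simp
  have u: "u \<le> 1 - r"
  proof -
    have "u = (1 - r) * (s * (1 + r))"
      by (simp add: u_def power2_eq_square algebra_simps)
    also have "\<dots> \<le> (1 - r) * 1"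
      using assms \<open>s * (1 + r) < 1\<close> by (intro mult_left_mono) auto
    finally show ?thesis by simp
  qed
  have "2 / (1 + r) \<le> ratio (r\<^sup>2) (1/2) (a, b) {0, a} {b, 1}"
  proof (rule le_ratioI)
    show "cost1 (r\<^sup>2) (a / 2, (1 + b) / 2) x \<le> (1 + r\<^sup>2 - u) / 2" if "x \<in> {0, a}" for x
      using that assms(3-6) by (auto simp: u_def s_def field_simps)
    show "cost2 (r\<^sup>2) (a / 2, (1 + b) / 2) y \<le> (1 + r\<^sup>2 - u) / 2" if "y \<in> {b, 1}" for y
      using that assms(3-6) by (auto simp: u_def s_def field_simps)
    \<comment> \<open>This is the desired bound after clearing denominators.\<close>
    have "r * u \<le> r * (1 - r)"
      using u assms by (intro mult_left_mono)
    then have "2 / (1 + r) * ((1 + r\<^sup>2 - u) / 2) \<le> 1 - u"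
      using assms by (simp add: field_simps power2_eq_square)
    also have "1 - u = cost1 (r\<^sup>2) (a, b) 0"
      using assms by (simp add: u_def s_def algebra_simps)
    also have "\<dots> \<le> max_cost (r\<^sup>2) (a, b) {0, a} {b, 1}"
      by (rule cost1_le_max_cost) auto
    finally show "2 / (1 + r) * ((1 + r\<^sup>2 - u) / 2) \<le> max_cost (r\<^sup>2) (a, b) {0, a} {b, 1}" .
    show "a \<in> {0, a}" "b \<in> {b, 1}" by auto
    show "b < a + 1" using s by (simp add: s_def)
  qed (use assms r2 in auto)
  also have "\<dots> \<le> F (r\<^sup>2) (1/2) a b"
    using assms r2 by (intro F_ge_ratio) auto
  finally show ?thesis .
qed

text \<open>With \<open>d = a + b\<close> and \<open>s = b - a\<close> this compares the cost of an
  agent at the obstacle with the optimum. The difference \<open>g\<close> of the two sides, scaled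
  by \<open>1 + r\<close>, is affine and decreasing in \<open>d\<close>, so \<open>d = 1\<close> is
  the worst case. There, after another multiplication by \<open>1 + r\<close>, the bound
  \<open>1 \<le> (1 + r) * s\<close> leaves a surplus of \<open>2 * r ^ 3\<close>.\<close>

lemma half_key_inequality:
  fixes r s d :: real
  assumes "0 \<le> r" "r < 1" "1 / (1 + r) \<le> s" "d \<le> 1"
  shows "2 / (1 + r) * (r\<^sup>2 * (1 - (d - s) / 2) + (1 - r\<^sup>2) * (3 / 2 - (d + s) / 2) / 2)
    \<le> 3 / 2 - d + r\<^sup>2 * s"
proof -
  define g where "g d = (1 + r) * (3 / 2 - d + r\<^sup>2 * s) -
    2 * (r\<^sup>2 * (1 - (d - s) / 2) + (1 - r\<^sup>2) * (3 / 2 - (d + s) / 2) / 2)" for d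
  have "0 \<le> g d"
  proof -
    have s: "1 \<le> (1 + r) * s"
      using assms by (simp add: pos_divide_le_eq mult.commute)
    have "g d - g 1 = (1 - d) * ((1 + 2 * r - r\<^sup>2) / 2)"
      by (simp add: g_def field_simps power2_eq_square)
    moreover have "0 \<le> (1 - d) * ((1 + 2 * r - r\<^sup>2) / 2)"
    proof -
      have "r * r \<le> r * 1"
        using assms by (intro mult_left_mono) auto
      then show ?thesis
        using assms by (intro mult_nonneg_nonneg) (auto simp: power2_eq_square)
    qed
    moreover have "2 * g 1 = (r - 1) + s * (1 - r\<^sup>2 + 2 * r ^ 3)"
      by (simp add: g_def field_simps power2_eq_square power3_eq_cube)
    moreover have "0 \<le> (r - 1) + s * (1 - r\<^sup>2 + 2 * r ^ 3)"
    proof -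
      have "r\<^sup>2 \<le> 1"
        using assms by (simp add: power_le_one)
      then have "1 * (1 - r\<^sup>2 + 2 * r ^ 3) \<le> ((1 + r) * s) * (1 - r\<^sup>2 + 2 * r ^ 3)"
        using assms by (intro mult_right_mono s) auto
      then have "2 * r ^ 3 \<le> (1 + r) * ((r - 1) + s * (1 - r\<^sup>2 + 2 * r ^ 3))"
        by (simp add: algebra_simps power2_eq_square)
      moreover have "0 \<le> 2 * r ^ 3"
        using assms by simp
      ultimately have "0 \<le> (1 + r) * ((r - 1) + s * (1 - r\<^sup>2 + 2 * r ^ 3))"
        by linarith
      then show ?thesis
        using assms by (simp only: zero_le_mult_iff) linarith
    qed
    ultimately show ?thesis
      by linarith
  qed
  moreover have "2 / (1 + r) * x \<le> y" if "0 \<le> (1 + r) * y - 2 * x" for x y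
    using that assms(1) by (simp add: pos_divide_le_eq mult.commute)
  ultimately show ?thesis
    unfolding g_def by blast
qed

lemma F_half_ge_left:
  assumes "0 \<le> r" "r < 1" "0 \<le> a" "a \<le> 1/2" "1/2 \<le> b" "b \<le> 1"
    and "1 / (1 + r) \<le> b - a" "a + b \<le> 1"
  shows "2 / (1 + r) \<le> F (r\<^sup>2) (1/2) a b"
proof -
  \<comment> \<open>This is the value of \<open>opt_cost_lower_bound\<close> for
    \<open>p = 1 - a\<close>, and the competing edge attains it: its left end is midway between
    \<open>a\<close> and 1/2, and its right end lies \<open>(1 - a - b) / 2\<close> beyond
    \<open>b\<close>, which equalizes all costs.\<close>
  define v where "v = r\<^sup>2 * (1 - a) + (1 - r\<^sup>2) * (3 / 2 - b) / 2"
  have r2: "0 \<le> r\<^sup>2" "r\<^sup>2 < 1"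
    using assms by (auto simp: power_less_one_iff)
  have "0 < 1 / (1 + r)"
    using assms by simp
  then have "a < b"
    using assms by linarith
  \<comment> \<open>An edge longer than 1/2 has both ends away from the obstacle, which keeps the
    competing edge admissible.\<close>
  moreover have "1 / 2 < 1 / (1 + r)"
    using assms by (simp add: field_simps)
  ultimately have ab: "a < b" "a < 1/2" "1/2 < b"
    using assms by linarith+
  have "2 / (1 + r) \<le> ratio (r\<^sup>2) (1/2) (a, b) {a, 1/2} {b, b}"
  proof (rule le_ratioI)
    show "cost1 (r\<^sup>2) (1 / 4 + a / 2, (1 - a + b) / 2) x \<le> v" if "x \<in> {a, 1/2}" for x
      using that assms(3-6,8) by (auto simp: v_def field_simps)
    show "cost2 (r\<^sup>2) (1 / 4 + a / 2, (1 - a + b) / 2) y \<le> v" if "y \<in> {b, b}" for y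
      using that assms(3-6,8) by (auto simp: v_def field_simps)
    have "2 / (1 + r) * v \<le> 3 / 2 - (a + b) + r\<^sup>2 * (b - a)"
      using half_key_inequality[OF assms(1,2,7,8)] by (simp add: v_def)
    also have "\<dots> = cost1 (r\<^sup>2) (a, b) (1/2)"
      using assms by (simp add: algebra_simps)
    also have "\<dots> \<le> max_cost (r\<^sup>2) (a, b) {a, 1/2} {b, b}"
      by (rule cost1_le_max_cost) auto
    finally show "2 / (1 + r) * v \<le> max_cost (r\<^sup>2) (a, b) {a, 1/2} {b, b}" .
    show "1/2 \<in> {a, 1/2}" "b \<in> {b, b}" by auto
  qed (use assms r2 ab in auto)
  also have "\<dots> \<le> F (r\<^sup>2) (1/2) a b"
    using assms r2 by (intro F_ge_ratio) auto
  finally show ?thesis .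
qed

text \<open>Mirror image of \<open>F_half_ge_left\<close>: reflection about 1/2 exchanges
  \<open>a\<close> with \<open>1 - b\<close>, and hence \<open>a + b\<close> with
  \<open>2 - (a + b)\<close>.\<close>

lemma F_half_ge_right:
  assumes "0 \<le> r" "r < 1" "0 \<le> a" "a \<le> 1/2" "1/2 \<le> b" "b \<le> 1"
    and "1 / (1 + r) \<le> b - a" "1 \<le> a + b"
  shows "2 / (1 + r) \<le> F (r\<^sup>2) (1/2) a b"
proof -
  define v where "v = r\<^sup>2 * b + (1 - r\<^sup>2) * (1 / 2 + a) / 2"
  have r2: "0 \<le> r\<^sup>2" "r\<^sup>2 < 1"
    using assms by (auto simp: power_less_one_iff)
  have "0 < 1 / (1 + r)"
    using assms by simp
  then have "a < b"
    using assms by linarith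
  moreover have "1 / 2 < 1 / (1 + r)"
    using assms by (simp add: field_simps)
  ultimately have ab: "a < b" "a < 1/2" "1/2 < b"
    using assms by linarith+
  have "2 / (1 + r) \<le> ratio (r\<^sup>2) (1/2) (a, b) {a, a} {1/2, b}"
  proof (rule le_ratioI)
    show "cost1 (r\<^sup>2) ((1 + a - b) / 2, 1 / 4 + b / 2) x \<le> v" if "x \<in> {a, a}" for x
      using that assms(3-6,8) by (auto simp: v_def field_simps)
    show "cost2 (r\<^sup>2) ((1 + a - b) / 2, 1 / 4 + b / 2) y \<le> v" if "y \<in> {1/2, b}" for y
      using that assms(3-6,8) by (auto simp: v_def field_simps)
    have "2 / (1 + r) * v \<le> (a + b) - 1 / 2 + r\<^sup>2 * (b - a)"
      using half_key_inequality[OF assms(1,2,7), of "2 - (a + b)"] assms(8)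
      by (simp add: v_def field_simps)
    also have "\<dots> = cost2 (r\<^sup>2) (a, b) (1/2)"
      using assms by (simp add: algebra_simps)
    also have "\<dots> \<le> max_cost (r\<^sup>2) (a, b) {a, a} {1/2, b}"
      by (rule cost2_le_max_cost) auto
    finally show "2 / (1 + r) * v \<le> max_cost (r\<^sup>2) (a, b) {a, a} {1/2, b}" .
    show "a \<in> {a, a}" "1/2 \<in> {1/2, b}" by auto
  qed (use assms r2 ab in auto)
  also have "\<dots> \<le> F (r\<^sup>2) (1/2) a b"
    using assms r2 by (intro F_ge_ratio) auto
  finally show ?thesis .
qed

lemma B_lower_bound:
  assumes "0 \<le> k" "k < 1"
  shows "2 / (1 + sqrt k) \<le> B k"
proof -
  let ?r = "sqrt k"
  have r: "0 \<le> ?r" "?r < 1" "?r\<^sup>2 = k"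
    using assms by auto
  have "2 / (1 + ?r) \<le> F k (1/2) a b" if "a \<in> {0..1/2}" "b \<in> {1/2..1}" for a b
    using F_half_ge_short[of ?r a b] F_half_ge_left[of ?r a b] F_half_ge_right[of ?r a b] that r
    by (cases "b - a < 1 / (1 + ?r)"; cases "a + b \<le> 1") auto
  then have "2 / (1 + ?r) \<le> F_inf k (1/2)"
    unfolding F_inf_def by (intro cINF_greatest) auto
  also have "\<dots> \<le> B k"
    using assms by (intro F_inf_le_B) auto
  finally show ?thesis .
qed

subsection \<open>Strategyproof mechanisms\<close>

context
  fixes f :: mechanism and k \<alpha> :: real
  assumes k: "0 \<le> k" "k < 1"
    and f: "is_mechanism f" "strategyproof k f"
    and \<alpha>: "\<And>ob xs. \<lbrakk>ob \<in> {0<..<1}; is_profile ob xs\<rbrakk> \<Longrightarrow> MC k ob (f ob xs) xs \<le> \<alpha> * OPT k ob xs"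
begin

text \<open>The edge from the midpoint of the two agents to 1 bounds the optimum, and this bound is
  largest for \<open>x\<close> tending to 1. The factor \<open>max \<alpha> 0\<close> avoids a case
  distinction on the sign of \<alpha>.\<close>

lemma pair_cost_le:
  assumes "0 \<le> z" "z \<le> x" "x < ob" "ob < 1" "f ob [z, x] = (a, b)" "y \<in> {z, x}"
  shows "\<bar>y - a\<bar> + k * (b - a) + (1 - b) \<le> max \<alpha> 0 * ((1 + k) / 2) * (1 - z)"
proof -
  have prof: "ob \<in> {0<..<1}" "is_profile ob [z, x]"
    using assms by (auto simp: is_profile_def)
  have locs: "N1_locs ob [z, x] = {z, x}" "N2_locs ob [z, x] = {}"
    using assms by (auto simp: N1_locs_def N2_locs_def)
  have "OPT k ob [z, x] \<le> max_cost k ((z + x) / 2, 1) {z, x} {}"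
    unfolding OPT_def locs using assms k by (intro opt_cost_le) (auto simp: edges_def)
  also have "\<dots> \<le> (1 + k) / 2 * (1 - z)"
  proof -
    have "x * (1 - k) \<le> 1 * (1 - k)"
      using k assms by (intro mult_right_mono) auto
    then show ?thesis
      using assms by (subst max_cost_le_iff) (auto simp: field_simps)
  qed
  finally have opt: "OPT k ob [z, x] \<le> (1 + k) / 2 * (1 - z)" .
  have "\<bar>y - a\<bar> + k * (b - a) + (1 - b) = cost1 k (f ob [z, x]) y"
    using assms by simp
  also have "\<dots> \<le> MC k ob (f ob [z, x]) [z, x]"
    unfolding MC_def locs using assms by (intro cost1_le_max_cost) auto
  also have "\<dots> \<le> \<alpha> * OPT k ob [z, x]"
    using prof by (rule \<alpha>)
  also have "\<dots> \<le> max \<alpha> 0 * OPT k ob [z, x]"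
    unfolding OPT_def locs using k assms by (intro mult_right_mono opt_cost_nonneg) auto
  also have "\<dots> \<le> max \<alpha> 0 * ((1 + k) / 2 * (1 - z))"
    using opt by (intro mult_left_mono) auto
  finally show ?thesis
    by (simp add: mult.assoc)
qed

lemma edge_bounds:
  assumes "0 \<le> z" "z \<le> x" "x < ob" "ob < 1" "f ob [z, x] = (a, b)"
  shows "0 \<le> a" "a < ob" "ob < b" "b \<le> 1"
proof -
  have "ob \<in> {0<..<1}" "is_profile ob [z, x]"
    using assms by (auto simp: is_profile_def)
  then have "f ob [z, x] \<in> edges ob"
    using f by (auto simp: is_mechanism_def)
  then show "0 \<le> a" "a < ob" "ob < b" "b \<le> 1"
    using assms by (auto simp: edges_def)
qed

lemma approximation_ge: "2 / (1 + k) \<le> \<alpha>"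
proof (rule ccontr)
  assume "\<not> 2 / (1 + k) \<le> \<alpha>"
  then have "max \<alpha> 0 < 2 / (1 + k)"
    using k by auto
  then have "max \<alpha> 0 * (1 + k) < 2"
    using k by (subst (asm) pos_less_divide_eq) auto
  \<comment> \<open>By \<open>pair_cost_le\<close>, both agents of a pair pay at most
    \<open>lam * (1 - z)\<close>.\<close>
  moreover define lam where "lam = max \<alpha> 0 * ((1 + k) / 2)"
  moreover have "0 \<le> max \<alpha> 0 * (1 + k)"
    using k by simp
  ultimately have lam: "0 \<le> lam" "lam < 1"
    by auto
  \<comment> \<open>The contraction factor lies midway between \<open>lam\<close> and 1; the slack
    \<open>(1 - lam) / 2\<close> absorbs the distance from \<open>x\<close> to 1.\<close>
  define q where "q = (1 + lam) / 2"
  have q: "0 < q" "q < 1"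
    using lam by (auto simp: q_def)
  then obtain N where N: "q ^ N < 1 - lam"
    using real_arch_pow_inv[of "1 - lam" q] lam by auto
  \<comment> \<open>The right agent and the obstacle stay fixed during all \<open>N\<close> steps,
    so \<delta> is adapted to the last and smallest scale \<open>q ^ N\<close>.\<close>
  define \<delta> where "\<delta> = (1 - lam) / 2 * q ^ N"
  define x where "x = 1 - \<delta>"
  define ob where "ob = 1 - \<delta> / 2"
  have \<delta>: "0 < \<delta>"
    using lam q by (simp add: \<delta>_def)
  have pow: "\<delta> \<le> (1 - lam) / 2 * q ^ n" "0 < q ^ n" "q ^ n \<le> 1" if "n \<le> N" for n
    using that q lam by (auto simp: \<delta>_def intro!: mult_left_mono power_decreasing power_le_one)
  have z: "0 \<le> 1 - q ^ n" "1 - q ^ n \<le> x" if "n \<le> N" for n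
  proof -
    have "(1 - lam) / 2 * q ^ n \<le> 1 * q ^ n"
      using lam pow[OF that] by (intro mult_right_mono) auto
    then have "\<delta> \<le> q ^ n"
      using pow(1)[OF that] by linarith
    then show "0 \<le> 1 - q ^ n" "1 - q ^ n \<le> x"
      using pow[OF that] by (simp_all add: x_def)
  qed
  have ob: "x < ob" "ob < 1"
    using \<delta> by (auto simp: x_def ob_def)
  \<comment> \<open>The left agent sits at \<open>1 - q ^ n\<close>; by this bound its next position
    is still not to the right of \<open>a\<close>.\<close>
  have a_bound: "1 - a \<le> q ^ Suc n" if "n \<le> N" "f ob [1 - q ^ n, x] = (a, b)" for n a b
  proof -
    have "\<bar>x - a\<bar> + k * (b - a) + (1 - b) \<le> lam * q ^ n"
      using pair_cost_le[OF z[OF that(1)] ob that(2), of x] by (simp add: lam_def)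
    moreover have "0 \<le> k * (b - a)" "0 \<le> 1 - b"
      using edge_bounds[OF z[OF that(1)] ob that(2)] k by simp_all
    ultimately have "x - a \<le> lam * q ^ n"
      by linarith
    then have "1 - a \<le> lam * q ^ n + (1 - lam) / 2 * q ^ n"
      using pow[OF that(1)] by (simp add: x_def)
    then show ?thesis
      by (simp add: q_def field_simps)
  qed
  \<comment> \<open>The invariant starts from the agent at 0, whose cost
    \<open>1 - (1 - k) * (b - a)\<close> is at most \<open>lam\<close>.\<close>
  have len: "1 - lam \<le> (1 - k) * (b - a)" if "n \<le> N" "f ob [1 - q ^ n, x] = (a, b)" for n a b
    using that
  proof (induction n arbitrary: a b)
    case 0
    then have e: "f ob [0, x] = (a, b)"
      by simp
    have x: "0 \<le> x"
      using z(2)[of 0] by simp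
    have "\<bar>0 - a\<bar> + k * (b - a) + (1 - b) \<le> lam * (1 - 0)"
      unfolding lam_def using x by (intro pair_cost_le[OF _ _ ob e]) auto
    moreover have "0 \<le> a"
      using x by (intro edge_bounds(1)[OF _ _ ob e]) auto
    ultimately show ?case
      by (simp add: algebra_simps)
  next
    case (Suc n)
    obtain a' b' where e: "f ob [1 - q ^ n, x] = (a', b')"
      by force
    have prof: "ob \<in> {0<..<1}" "is_profile ob [1 - q ^ Suc n, x]"
      using z[of "Suc n"] Suc.prems ob by (auto simp: is_profile_def)
    have "\<forall>i<length [1 - q ^ Suc n, x]. \<forall>y. same_region ob ([1 - q ^ Suc n, x] ! i) y \<longrightarrow>
        cost k ob (f ob [1 - q ^ Suc n, x]) ([1 - q ^ Suc n, x] ! i)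
        \<le> cost k ob (f ob ([1 - q ^ Suc n, x][i := y])) ([1 - q ^ Suc n, x] ! i)"
      using f(2) prof unfolding strategyproof_def by blast
    \<comment> \<open>The left agent is truly at \<open>1 - q ^ Suc n\<close> and could restore the
      previous edge \<open>(a', b')\<close> by reporting \<open>1 - q ^ n\<close>.\<close>
    from this[rule_format, of 0 "1 - q ^ n"]
    have "cost k ob (a, b) (1 - q ^ Suc n) \<le> cost k ob (a', b') (1 - q ^ Suc n)"
      using z[of n] z[of "Suc n"] ob Suc.prems e by (auto simp: same_region_def)
    moreover have "1 - q ^ Suc n < ob"
      using z[of "Suc n"] Suc.prems ob by auto
    \<comment> \<open>At the true location \<open>z\<close> the previous edge therefore costs
      exactly \<open>1 - z - (1 - k) * (b' - a')\<close>, and the new edge costs at least the same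
      expression in \<open>a\<close> and \<open>b\<close>.\<close>
    moreover have "1 - q ^ Suc n \<le> a'"
      using a_bound[OF _ e] Suc.prems by simp
    ultimately have "(1 - k) * (b' - a') \<le> (1 - k) * (b - a)"
      by (simp add: cost_def algebra_simps abs_if split: if_splits)
    with Suc.IH[OF _ e] Suc.prems show ?case
      by linarith
  qed
  obtain a b where e: "f ob [1 - q ^ N, x] = (a, b)"
    by force
  note ab = edge_bounds[OF z[OF order_refl] ob e]
  have "(1 - k) * (b - a) \<le> 1 * (b - a)"
    using k ab by (intro mult_right_mono) auto
  also have "\<dots> \<le> q * q ^ N"
    using a_bound[OF _ e] ab by simp
  also have "\<dots> \<le> 1 * q ^ N"
    using q by (intro mult_right_mono) auto
  finally show False
    using len[OF _ e] N by simp
qed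

end

lemma approx_ratio_ge:
  assumes "0 \<le> k" "k < 1" "is_mechanism f" "strategyproof k f"
  shows "ereal (2 / (1 + k)) \<le> approx_ratio k f"
  unfolding approx_ratio_def
  by (rule Inf_greatest) (use approximation_ge[OF assms] in auto)

subsection \<open>The grid error\<close>

lemma nearest_endpoint:
  fixes t lo hi :: real
  assumes "lo \<le> t" "t \<le> hi"
  obtains c where "c \<in> {lo, hi}" "\<bar>t - c\<bar> \<le> (hi - lo) / 2"
  using assms by (cases "t - lo \<le> hi - t") (use that[of lo] that[of hi] in auto)

lemma unit_interval_cell:
  fixes t :: real
  assumes "0 < M" "0 \<le> t" "t \<le> 1"
  obtains i where "i < M" "real i / real M \<le> t" "t \<le> (real i + 1) / real M"
\<comment> \<open>At \<open>t = 1\<close> the floor would give index \<open>M\<close>, which is out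
  of range; the last cell has index \<open>M - 1\<close>.\<close>
proof (cases "t = 1")
  case True
  then show ?thesis
    using assms that[of "M - 1"] by auto
next
  case False
  let ?i = "nat \<lfloor>t * real M\<rfloor>"
  have "t * real M < 1 * real M"
    using False assms by (intro mult_strict_right_mono) auto
  then have "?i < M"
    using assms by (simp add: floor_less_iff nat_less_iff)
  moreover have "real ?i \<le> t * real M" "t * real M \<le> real ?i + 1"
    using assms by simp_all
  ultimately show ?thesis
    using assms that[of ?i] by (simp add: field_simps)
qed

context
  fixes N :: nat and ob :: real
  assumes N: "2 \<le> N" and ob: "1/2 \<le> ob" "ob < 1"
begin

lemma grid_diff:
  "grid_a N ob (Suc i) - grid_a N ob i = ob / (real N - 1)"
  "grid_b N ob (Suc j) - grid_b N ob j = (1 - ob) / (real N - 1)"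
  by (simp_all add: grid_a_def grid_b_def add_divide_distrib distrib_left)

lemma grid_less:
  "grid_a N ob i < grid_a N ob (Suc i)" "grid_b N ob j < grid_b N ob (Suc j)"
proof -
  have "0 < ob / (real N - 1)" "0 < (1 - ob) / (real N - 1)"
    using N ob by auto
  then show "grid_a N ob i < grid_a N ob (Suc i)" "grid_b N ob j < grid_b N ob (Suc j)"
    using grid_diff(1)[of i] grid_diff(2)[of j] by linarith+
qed

lemma grid_range:
  assumes "i < N"
  shows "0 \<le> grid_a N ob i" "grid_a N ob i \<le> ob" "ob \<le> grid_b N ob i" "grid_b N ob i \<le> 1"
proof -
  have i: "0 \<le> real i / (real N - 1)" "real i / (real N - 1) \<le> 1"
    using assms N by auto
  then show "0 \<le> grid_a N ob i" "ob \<le> grid_b N ob i"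
    using ob by (auto simp: grid_a_def grid_b_def simp del: times_divide_eq_right)
  show "grid_a N ob i \<le> ob"
    using mult_left_mono[OF i(2), of ob] ob by (simp add: grid_a_def)
  show "grid_b N ob i \<le> 1"
    using mult_left_mono[OF i(2), of "1 - ob"] ob by (simp add: grid_b_def)
qed

lemma grid_cell_subset:
  assumes "i < N - 1" "j < N - 1"
  shows "grid_cell N ob i j \<subseteq> {0..ob} \<times> {ob..1}"
proof -
  have "i < N" "Suc i < N" "j < N" "Suc j < N"
    using assms by auto
  then show ?thesis
    using grid_range[of i] grid_range[of "Suc i"] grid_range[of j] grid_range[of "Suc j"]
    by (auto simp: grid_cell_def)
qed

lemma grid_cells_cover:
  assumes "a \<in> {0..ob}" "b \<in> {ob..1}"
  obtains i j where "i < N - 1" "j < N - 1" "(a, b) \<in> grid_cell N ob i j"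
proof -
  have M: "0 < N - 1" "real (N - 1) = real N - 1"
    using N by auto
  obtain i where i: "i < N - 1" "real i / (real N - 1) \<le> a / ob" "a / ob \<le> (real i + 1) / (real N - 1)"
    using unit_interval_cell[OF M(1), of "a / ob"] assms ob unfolding M(2) by auto
  obtain j where j: "j < N - 1" "real j / (real N - 1) \<le> (b - ob) / (1 - ob)"
      "(b - ob) / (1 - ob) \<le> (real j + 1) / (real N - 1)"
    using unit_interval_cell[OF M(1), of "(b - ob) / (1 - ob)"] assms ob unfolding M(2) by auto
  have "(a, b) \<in> grid_cell N ob i j"
    using mult_left_mono[OF i(2), of ob] mult_left_mono[OF i(3), of ob]
      mult_left_mono[OF j(2), of "1 - ob"] mult_left_mono[OF j(3), of "1 - ob"] ob
    by (simp add: grid_cell_def grid_a_def grid_b_def add.commute)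
  with i j show ?thesis
    using that by blast
qed

text \<open>Finitely many cells cover the rectangle. If each cell infimum exceeded
  \<open>F_inf\<close>, so would their minimum, which is however a lower bound of \<open>F\<close>
  on the whole rectangle.\<close>

lemma relevant_cell_exists:
  assumes "0 \<le> k" "k < 1"
  obtains i j where "relevant_cell N k ob i j"
proof (rule ccontr)
  let ?I = "{..<N - 1} \<times> {..<N - 1}"
  let ?m = "\<lambda>(i, j). INF (a, b)\<in>grid_cell N ob i j. F k ob a b"
  assume "\<not> thesis"
  then have ne: "?m p \<noteq> F_inf k ob" if "p \<in> ?I" for p
    using that \<open>\<And>i j. relevant_cell N k ob i j \<Longrightarrow> thesis\<close> by (auto simp: relevant_cell_def)
  have bdd: "bdd_below ((\<lambda>(a, b). F k ob a b) ` grid_cell N ob i j)" if "(i, j) \<in> ?I" for i j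
    using that assms ob grid_cell_subset[of i j]
    by (intro bdd_belowI2[where m = 0]) (auto intro!: F_nonneg)
  have nonempty: "grid_cell N ob i j \<noteq> {}" for i j
    using grid_less by (auto simp: grid_cell_def less_imp_le)
  have "F_inf k ob < ?m p" if p: "p \<in> ?I" for p
  proof -
    obtain i j where ij: "p = (i, j)" "i < N - 1" "j < N - 1"
      using p by auto
    have "F_inf k ob \<le> ?m p"
      using nonempty grid_cell_subset[OF ij(2,3)] assms ob unfolding ij(1)
      by (auto intro!: cINF_greatest F_inf_le)
    with ne[OF p] show ?thesis by simp
  qed
  moreover have I: "finite (?m ` ?I)" "?m ` ?I \<noteq> {}"
    using N by (auto simp: lessThan_empty_iff)
  ultimately have "F_inf k ob < Min (?m ` ?I)"
    by (subst Min_gr_iff) auto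
  also have "Min (?m ` ?I) \<le> F_inf k ob"
    unfolding F_inf_def
  proof (rule cINF_greatest)
    fix p :: "real \<times> real"
    assume "p \<in> {0..ob} \<times> {ob..1}"
    then obtain a b where p: "p = (a, b)" "a \<in> {0..ob}" "b \<in> {ob..1}"
      by auto
    then obtain i j where ij: "(i, j) \<in> ?I" "(a, b) \<in> grid_cell N ob i j"
      using grid_cells_cover[OF p(2,3)] by (metis SigmaI lessThan_iff)
    have "Min (?m ` ?I) \<le> ?m (i, j)"
      using I ij(1) by (intro Min_le) blast+
    also have "\<dots> \<le> F k ob a b"
      using cINF_lower[OF bdd[OF ij(1)] ij(2)] by simp
    finally show "Min (?m ` ?I) \<le> (case p of (a, b) \<Rightarrow> F k ob a b)"
      using p by simp
  qed (use ob in auto)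
  finally show False by simp
qed

text \<open>Each point of a relevant cell is within half a cell width of some corner in each
  coordinate. The sides \<open>ob\<close> and \<open>1 - ob\<close> of the rectangle add up to 1, so
  the l1 distance to that corner is at most \<open>1 / (2 * (real N - 1))\<close>.\<close>

lemma locally_lipschitz_grid_error_bound:
  assumes k: "0 \<le> k" "k < 1" and lip: "locally_lipschitz S N k ob"
  shows "grid_error_bound S N k ob"
proof -
  obtain i j where rel: "relevant_cell N k ob i j"
    using relevant_cell_exists k by blast
  then have ij: "i < N - 1" "j < N - 1"
    and inf: "(INF (a, b)\<in>grid_cell N ob i j. F k ob a b) = F_inf k ob"
    by (auto simp: relevant_cell_def)
  have lip': "\<bar>F k ob a b - F k ob a' b'\<bar> \<le> S * (\<bar>a - a'\<bar> + \<bar>b - b'\<bar>)"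
    if "(a, b) \<in> grid_cell N ob i j" "(a', b') \<in> grid_cell N ob i j" for a b a' b'
    using lip rel that unfolding locally_lipschitz_def l1_lipschitz_on_def by blast
  have M: "0 < real N - 1"
    using N by simp
  have corner: "(grid_a N ob i', grid_b N ob j') \<in> grid_cell N ob i j"
    if "i' \<in> {i, Suc i}" "j' \<in> {j, Suc j}" for i' j'
    using that grid_less by (auto simp: grid_cell_def less_imp_le)
  \<comment> \<open>Two distinct corners of the cell force the Lipschitz constant to be
    nonnegative.\<close>
  have "0 \<le> S * (\<bar>grid_a N ob i - grid_a N ob (Suc i)\<bar> + 0)"
    using lip'[OF corner[of i j] corner[of "Suc i" j]] by auto
  then have S: "0 \<le> S"
    using grid_less(1)[of i] by (auto simp: zero_le_mult_iff)
  have "F_grid_min N k ob - S / (2 * (real N - 1)) \<le> F_inf k ob"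
    unfolding inf[symmetric]
  proof (rule cINF_greatest)
    fix p assume "p \<in> grid_cell N ob i j"
    then obtain a b where p: "p = (a, b)" "(a, b) \<in> grid_cell N ob i j"
        "grid_a N ob i \<le> a" "a \<le> grid_a N ob (Suc i)" "grid_b N ob j \<le> b" "b \<le> grid_b N ob (Suc j)"
      by (auto simp: grid_cell_def)
    obtain i' where i': "i' \<in> {i, Suc i}" "\<bar>a - grid_a N ob i'\<bar> \<le> ob / (real N - 1) / 2"
      using nearest_endpoint[OF p(3,4)] grid_diff(1)[of i] by (metis insert_iff empty_iff)
    obtain j' where j': "j' \<in> {j, Suc j}" "\<bar>b - grid_b N ob j'\<bar> \<le> (1 - ob) / (real N - 1) / 2"
      using nearest_endpoint[OF p(5,6)] grid_diff(2)[of j] by (metis insert_iff empty_iff)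
    have "F_grid_min N k ob \<le> F k ob (grid_a N ob i') (grid_b N ob j')"
      unfolding F_grid_min_def
    proof (rule Min_le)
      have "(i', j') \<in> {..<N} \<times> {..<N}"
        using i' j' ij by auto
      then show "F k ob (grid_a N ob i') (grid_b N ob j')
        \<in> (\<lambda>(i, j). F k ob (grid_a N ob i) (grid_b N ob j)) ` ({..<N} \<times> {..<N})"
        by (rule rev_image_eqI) simp
    qed auto
    also have "\<dots> \<le> F k ob a b + S * (\<bar>a - grid_a N ob i'\<bar> + \<bar>b - grid_b N ob j'\<bar>)"
      using lip'[OF p(2) corner[OF i'(1) j'(1)]] by linarith
    also have "S * (\<bar>a - grid_a N ob i'\<bar> + \<bar>b - grid_b N ob j'\<bar>)
        \<le> S * (ob / (real N - 1) / 2 + (1 - ob) / (real N - 1) / 2)"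
      using i' j' S by (intro mult_left_mono add_mono)
    also have "\<dots> = S / (2 * (real N - 1))"
      using M by (simp add: field_simps)
    finally show "F_grid_min N k ob - S / (2 * (real N - 1)) \<le> (case p of (a, b) \<Rightarrow> F k ob a b)"
      using p by simp
  qed (use corner[of i j] in auto)
  then show ?thesis
    by (simp add: grid_error_bound_def)
qed

end

lemma B_grid_le:
  assumes "0 \<le> k" "k < 1" "\<forall>ob\<in>{1/2..<1}. grid_error_bound 5 1000 k ob"
  shows "B_grid 1000 k - 0.003 \<le> B k"
proof -
  \<comment> \<open>Here \<open>5 / (2 * 999)\<close> is rounded up to 0.003, uniformly in the
    obstacle, so the estimate passes to the supremum.\<close>
  have "F_grid_min 1000 k ob \<le> B k + 0.003" if ob: "ob \<in> {1/2..<1}" for ob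
    using assms(3) ob F_inf_le_B[OF assms(1,2) ob] by (force simp: grid_error_bound_def)
  then have "B_grid 1000 k \<le> B k + 0.003"
    unfolding B_grid_def by (intro cSUP_least) auto
  then show ?thesis by simp
qed

theorem proposition1:
  fixes k :: real
  assumes "0 \<le> k" and "k < 1"
  shows "(\<forall>f. is_mechanism f \<and> anonymous f \<and> strategyproof k f \<longrightarrow> ereal (B k) \<le> approx_ratio k f)
    \<and> B k \<ge> 2 / (1 + sqrt k)
    \<and> (\<forall>S N. \<forall>ob\<in>{1/2..<1}. 2 \<le> N \<and> locally_lipschitz S N k ob \<longrightarrow> grid_error_bound S N k ob)
    \<and> ((\<forall>ob\<in>{1/2..<1}. grid_error_bound 5 1000 k ob) \<longrightarrow>
        max (2 / (1 + sqrt k)) (B_grid 1000 k - 0.003) \<le> B k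
        \<and> (\<forall>f. is_mechanism f \<and> anonymous f \<and> strategyproof k f \<longrightarrow>
              ereal (max (2 / (1 + sqrt k)) (B_grid 1000 k - 0.003)) \<le> approx_ratio k f))"
proof -
  have ratio: "ereal (B k) \<le> approx_ratio k f" if "is_mechanism f" "strategyproof k f" for f
  proof -
    have "ereal (B k) \<le> ereal (2 / (1 + k))"
      using B_le[OF assms] by simp
    also have "\<dots> \<le> approx_ratio k f"
      by (rule approx_ratio_ge[OF assms that])
    finally show ?thesis .
  qed
  have grid: "max (2 / (1 + sqrt k)) (B_grid 1000 k - 0.003) \<le> B k"
    if "\<forall>ob\<in>{1/2..<1}. grid_error_bound 5 1000 k ob"
    using B_lower_bound[OF assms] B_grid_le[OF assms that] by simp
  have "ereal (max (2 / (1 + sqrt k)) (B_grid 1000 k - 0.003)) \<le> approx_ratio k f"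
    if "\<forall>ob\<in>{1/2..<1}. grid_error_bound 5 1000 k ob" "is_mechanism f" "strategyproof k f" for f
  proof -
    have "ereal (max (2 / (1 + sqrt k)) (B_grid 1000 k - 0.003)) \<le> ereal (B k)"
      unfolding ereal_less_eq(3) by (rule grid[OF that(1)])
    also have "\<dots> \<le> approx_ratio k f"
      by (rule ratio[OF that(2,3)])
    finally show ?thesis .
  qed
  moreover have "grid_error_bound S N k ob"
    if "ob \<in> {1/2..<1}" "2 \<le> N" "locally_lipschitz S N k ob" for S N ob
    by (rule locally_lipschitz_grid_error_bound) (use that assms in auto)
  ultimately show ?thesis
    using B_lower_bound[OF assms] ratio grid by blast
qed

end
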